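(* For all $s \in (0,\infty)$, $u \in \ell^2(\mathbb{Z})$, $n \in \mathbb{Z}$ it holds that $$\big((-\Delta)^s u\big)(n) = \lim_{z\to s}\left[\sum_{k\in\mathbb{Z}} K_z(n-k)\,\big(u(n)-u(k)\big)\right],$$ where the limit is taken over $z$ in the domain $(0,\infty)\setminus\mathbb{N}$ on which $K_z$ is defined.
   Context: $\mathbb{N} = \{1,2,3,\ldots\}$, $\mathbb{N}_0=\mathbb{N}\cup\{0\}$. $\ell^2(\mathbb{Z})$ is the set of all $u \colon \mathbb{Z} \to \mathbb{R}$ with $\sum_{k\in\mathbb{Z}} |u(k)|^2 < \infty$. $\Gamma$ is the Gamma function (meromorphically continued), with the convention $1/\Gamma(w) = 0$ for $w \in \{\ldots,-2,-1,0\}$. The discrete fractional kernel: for $z \in (0,\infty)\setminus\mathbb{N}$ the function $K_z \colon \mathbb{Z}\to\mathbb{R}$ is given by $K_z(0)=0$ and, for $k \ne 0$, $$K_z(k) = \frac{-4^z\,\Gamma(\tfrac12+z)\,\Gamma(|k|-z)}{\sqrt{\pi}\,\Gamma(-z)\,\Gamma(|k|+1+z)}.$$ The discrete Laplace operator $\Delta \colon \ell^2(\mathbb{Z}) \to \ell^2(\mathbb{Z})$ is $(\Delta u)(n) = u(n-1) - 2u(n) + u(n+1)$. Integer powers are defined by iteration: $(-\Delta)^0 u = u$ and $(-\Delta)^k u = -\Delta\big((-\Delta)^{k-1}u\big)$ for $k\in\mathbb{N}$. The discrete heat semigroup $S_t(\Delta) \colon \ell^2(\mathbb{Z}) \to \ell^2(\mathbb{Z})$,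 $t \in [0,\infty)$, is $$(S_t(\Delta)u)(n) = \sum_{k\in\mathbb{Z}} \exp(-2t)\left[\sum_{j\in\mathbb{N}_0} \frac{t^{2j+n-k}}{\Gamma(1+j)\,\Gamma(j+n-k+1)}\right] u(k),$$ where terms with $j+n-k+1 \le 0$ are zero by the convention on $1/\Gamma$, and $0^0=1$. $\mathbb{I}$ is the identity operator. The discrete fractional Laplace operator $(-\Delta)^s \colon \ell^2(\mathbb{Z}) \to \ell^2(\mathbb{Z})$ for $s\in(0,\infty)$: if $s \in \mathbb{N}$ it is the integer power above; if $s \notin \mathbb{N}$, with $\lfloor s\rfloor$ the integer part of $s$, $$\big((-\Delta)^s u\big)(n) = \frac{1}{\Gamma(-(s-\lfloor s\rfloor))}\int_0^\infty t^{-(s-\lfloor s\rfloor)-1}\,\Big([S_t(\Delta)-\mathbb{I}]\,(-\Delta)^{\lfloor s\rfloor}u\Big)(n)\,dt .$$ *)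

theory Defs
  imports "HOL-Analysis.Analysis"
begin

definition ell2 :: "(int \<Rightarrow> real) set" where
  "ell2 = {u. (\<lambda>k. \<bar>u k\<bar>\<^sup>2) summable_on UNIV}"

text \<open>The kernel is meant for \<open>z \<in> {0<..} - \<nat>\<close>, where no argument of \<^const>\<open>Gamma\<close> is a pole.\<close>

definition frac_kernel :: "real \<Rightarrow> int \<Rightarrow> real" where
  "frac_kernel z k =
    (if k = 0 then 0
     else - (4 powr z) * Gamma (1/2 + z) * Gamma (of_int \<bar>k\<bar> - z)
          / (sqrt pi * Gamma (- z) * Gamma (of_int \<bar>k\<bar> + 1 + z)))"

definition discrete_laplace :: "(int \<Rightarrow> real) \<Rightarrow> int \<Rightarrow> real" where
  "discrete_laplace u n = u (n - 1) - 2 * u n + u (n + 1)"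

definition neg_laplace_pow :: "nat \<Rightarrow> (int \<Rightarrow> real) \<Rightarrow> int \<Rightarrow> real" where
  "neg_laplace_pow k = (\<lambda>v m. - discrete_laplace v m) ^^ k"

text \<open>
  \<^const>\<open>rGamma\<close> is the entire function \<open>1 / \<Gamma>\<close>, equal to \<open>0\<close> at the non-positive integers.
  The exponent \<open>2 * int j + n - k\<close> is negative only in terms that vanish for this reason,
  and \<open>0 powi 0 = 1\<close>.
\<close>

definition heat_semigroup :: "real \<Rightarrow> (int \<Rightarrow> real) \<Rightarrow> int \<Rightarrow> real" where
  "heat_semigroup t u n =
    (\<Sum>\<^sub>\<infinity>k\<in>UNIV. exp (- 2 * t)
        * (\<Sum>j. t powi (2 * int j + n - k) * rGamma (1 + of_nat j) * rGamma (of_int (int j + n - k + 1)))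
        * u k)"

definition frac_laplace :: "real \<Rightarrow> (int \<Rightarrow> real) \<Rightarrow> int \<Rightarrow> real" where
  "frac_laplace s u n =
    (if s \<in> \<nat> then neg_laplace_pow (nat \<lfloor>s\<rfloor>) u n
     else 1 / Gamma (- (s - of_int \<lfloor>s\<rfloor>)) *
       (LBINT t:{0<..}. t powr (- (s - of_int \<lfloor>s\<rfloor>) - 1)
          * (heat_semigroup t (neg_laplace_pow (nat \<lfloor>s\<rfloor>) u) n - neg_laplace_pow (nat \<lfloor>s\<rfloor>) u n)))"

end

theory Submission
  imports Defs
begin

text \<open>
  On the circle, \<open>-\<Delta>\<close> is multiplication by \<open>2 - 2 cos \<theta>\<close>, so \<open>(-\<Delta>)\<^sup>z\<close> should be convolution with the
  Fourier coefficients of \<open>(2 - 2 cos \<theta>)\<^sup>z\<close>. These coefficients are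
  \<open>c(z) (-z)\<^sub>k / (1 + z)\<^sub>k\<close> with \<open>k\<close> replaced by \<open>\<bar>k\<bar>\<close>, rising factorials, and
  \<open>c(z) = 4\<^sup>z \<Gamma>(1/2 + z) / (\<surd>\<pi> \<Gamma>(1 + z))\<close>; this is the function \<open>laplace_kernel z\<close> below.
  Away from \<open>k = 0\<close> it is \<open>-K\<^sub>z(k)\<close>, but unlike the defining formula of \<open>K\<^sub>z\<close> it has no
  removable singularities at integer \<open>z\<close>. Instead of Fourier
  analysis, the proof rests on two recurrences for this explicit kernel.

  The recurrence in \<open>k\<close> makes the partial sums of the kernel telescope. Hence the kernel is absolutely
  summable with total sum \<open>0\<close>, so that \<open>\<Sum>\<^sub>k K\<^sub>z(n - k) (u(n) - u(k))\<close> is the convolution of the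
  kernel with \<open>u\<close> (\<open>infsum_frac_kernel_eq_convolve\<close>). It also dominates the kernels for all \<open>z\<close> near
  \<open>s\<close> by one summable sequence, so the convolution is continuous in \<open>z\<close>, at integers too, by Tannery's
  theorem (\<open>tendsto_convolve_laplace_kernel\<close>). It remains to see that the value at \<open>z = s\<close> is
  \<open>(-\<Delta>)\<^sup>s u\<close> (\<open>frac_laplace_eq_convolve\<close>).

  The recurrence in \<open>z\<close> says that \<open>-\<Delta>\<close> maps the kernel at \<open>z\<close> to the kernel at \<open>z + 1\<close>. Since the kernel
  at \<open>0\<close> is the unit mass at \<open>0\<close>, this settles integer \<open>s\<close>, and it reduces the other \<open>s\<close> to
  \<open>0 < s < 1\<close>. In that range, the heat kernel \<open>G\<^sub>t\<close> is nonnegative with total mass \<open>1\<close>, so that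
  \<open>(S\<^sub>t u - u)(n) = \<Sum>\<^sub>k G\<^sub>t(n - k) (u(k) - u(n))\<close>, and the claim follows by exchanging sum and
  integral once \<open>\<integral> t\<^sup>-\<^sup>s\<^sup>-\<^sup>1 G\<^sub>t(m) dt = \<Gamma>(-s) laplace_kernel s m\<close> is known for \<open>m \<noteq> 0\<close>. Integrating
  the power series of \<open>G\<^sub>t\<close> term by term gives, after Legendre's duplication formula, a hypergeometric
  series at \<open>1\<close>, which Gauss's theorem evaluates (\<open>Gauss_hypergeometric_sums\<close>).
\<close>

section \<open>Sums over the integers\<close>

lemma has_sum_diff:
  fixes f g :: "'a \<Rightarrow> real"
  assumes "(f has_sum a) A" "(g has_sum b) A"
  shows "((\<lambda>x. f x - g x) has_sum (a - b)) A"
  using has_sum_add[OF assms(1), of "\<lambda>x. - g x" "- b"] assms(2) by (simp add: has_sum_uminus)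

lemma has_sum_int_even:
  fixes f :: "nat \<Rightarrow> real"
  assumes "(f has_sum S) UNIV"
  shows "((\<lambda>k::int. f (nat \<bar>k\<bar>)) has_sum (2 * S - f 0)) UNIV"
proof -
  have 1: "((\<lambda>k::int. f (nat \<bar>k\<bar>)) has_sum S) {0..}"
    by (subst has_sum_reindex_bij_witness[where i = int and j = nat and T = UNIV and h = f])
       (use assms in auto)
  have "(f has_sum (S - f 0)) (UNIV - {0})"
    using has_sum_Diff[OF assms, of "{0}" "f 0"] by (simp add: has_sum_finiteI)
  then have 2: "((\<lambda>k::int. f (nat \<bar>k\<bar>)) has_sum (S - f 0)) {..<0}"
    by (subst has_sum_reindex_bij_witness[where i = "\<lambda>n. - int n" and j = "\<lambda>k. nat (- k)" and T = "UNIV - {0}" and h = f])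
       auto
  have "((\<lambda>k::int. f (nat \<bar>k\<bar>)) has_sum (S + (S - f 0))) ({0..} \<union> {..<0})"
    by (intro has_sum_Un_disjoint 1 2) auto
  moreover have "{0..} \<union> {..<0} = (UNIV :: int set)" by auto
  ultimately show ?thesis by (simp add: algebra_simps)
qed

text \<open>
  Enumerating the integers turns unordered sums over them into series, to which Tannery's theorem and
  the exchange of series and integral apply.
\<close>

lemma infsum_int_eq_suminf:
  fixes f :: "int \<Rightarrow> real"
  assumes "f summable_on UNIV"
  shows "infsum f UNIV = (\<Sum>i. f (int_decode i))" "summable (\<lambda>i. \<bar>f (int_decode i)\<bar>)"
proof -
  have b: "bij int_decode" by (simp add: bij_int_decode)
  have "(f has_sum infsum f UNIV) UNIV" using assms by simp
  then have "((\<lambda>i. f (int_decode i)) has_sum infsum f UNIV) UNIV"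
    by (subst has_sum_reindex_bij_betw[OF b])
  then show "infsum f UNIV = (\<Sum>i. f (int_decode i))"
    using has_sum_imp_sums sums_unique by blast
  have "(\<lambda>k. \<bar>f k\<bar>) summable_on UNIV"
    using assms summable_on_iff_abs_summable_on_real[of f] by simp
  then have "(\<lambda>i. \<bar>f (int_decode i)\<bar>) summable_on UNIV"
    by (subst summable_on_reindex_bij_betw[OF b])
  then show "summable (\<lambda>i. \<bar>f (int_decode i)\<bar>)"
    by (rule summable_on_imp_summable)
qed

lemma bij_int_reflect: "bij (\<lambda>k::int. n - k)"
  by (rule bij_betwI[where g = "\<lambda>k. n - k"]) auto

lemma summable_on_reflect:
  fixes a :: "int \<Rightarrow> real"
  shows "(\<lambda>k. a (n - k)) summable_on UNIV \<longleftrightarrow> a summable_on UNIV"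
  by (rule summable_on_reindex_bij_betw[OF bij_int_reflect])

lemma infsum_reflect:
  fixes a :: "int \<Rightarrow> real"
  shows "(\<Sum>\<^sub>\<infinity>k. a (n - k)) = infsum a UNIV"
  by (rule infsum_reindex_bij_betw[OF bij_int_reflect])

lemma summable_on_mult_bounded:
  fixes a :: "int \<Rightarrow> real"
  assumes "a summable_on UNIV" "bounded (range u)"
  shows "(\<lambda>k. a k * u k) summable_on UNIV"
proof -
  obtain B where B: "\<And>k. \<bar>u k\<bar> \<le> B" using assms by (auto simp: bounded_iff)
  have "(\<lambda>k. \<bar>a k\<bar> * B) summable_on UNIV"
    using assms(1) summable_on_iff_abs_summable_on_real[of a UNIV] by (intro summable_on_cmult_left) simp
  then have "(\<lambda>k. norm (a k * u k)) summable_on UNIV"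
    by (rule Infinite_Sum.abs_summable_on_comparison_test') (auto simp: abs_mult intro!: mult_left_mono B)
  then show ?thesis by (rule abs_summable_summable)
qed

section \<open>The kernel as a quotient of Pochhammer symbols\<close>

definition pochhammer_ratio :: "real \<Rightarrow> nat \<Rightarrow> real" where
  "pochhammer_ratio z k = pochhammer (- z) k / pochhammer (1 + z) k"

definition laplace_const :: "real \<Rightarrow> real" where
  "laplace_const z = 4 powr z * Gamma (1/2 + z) / (sqrt pi * Gamma (1 + z))"

text \<open>
  The \<open>k\<close>-th Fourier coefficient of \<open>(2 - 2 cos \<theta>)\<^sup>z\<close>. In this form it is visibly continuous in
  \<open>z > 0\<close>, whereas at a positive integer \<open>z\<close> the factor \<open>\<Gamma>(-z)\<close> in the formula for \<open>frac_kernel\<close> has a pole.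
\<close>

definition laplace_kernel :: "real \<Rightarrow> int \<Rightarrow> real" where
  "laplace_kernel z k = laplace_const z * pochhammer_ratio z (nat \<bar>k\<bar>)"

lemma pochhammer_ratio_0 [simp]: "pochhammer_ratio z 0 = 1"
  by (simp add: pochhammer_ratio_def)

lemma pochhammer_ratio_Suc:
  assumes "z \<ge> 0"
  shows "(real k + 1 + z) * pochhammer_ratio z (Suc k) = (real k - z) * pochhammer_ratio z k"
proof -
  have "pochhammer (1 + z) k > 0" "pochhammer (1 + z) (Suc k) > 0"
    using assms by (auto intro!: pochhammer_pos)
  then show ?thesis
    using assms unfolding pochhammer_ratio_def by (simp add: pochhammer_Suc field_simps)
qed

lemma frac_kernel_eq_laplace_kernel:
  assumes z: "z > 0" "z \<notin> \<nat>" and k: "k \<noteq> 0"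
  shows "frac_kernel z k = - laplace_kernel z k"
proof -
  define m where "m = nat \<bar>k\<bar>"
  have m: "of_int \<bar>k\<bar> = real m" by (simp add: m_def)
  have nz: "- z \<notin> \<int>\<^sub>\<le>\<^sub>0"
    using z by (auto elim!: nonpos_Ints_cases')
  have nz': "1 + z \<notin> \<int>\<^sub>\<le>\<^sub>0"
    using z by (auto elim!: nonpos_Ints_cases')
  have "pochhammer (- z) m = Gamma (real m - z) / Gamma (- z)"
    using pochhammer_Gamma[OF nz, of m] by (simp add: algebra_simps)
  moreover have "pochhammer (1 + z) m = Gamma (real m + 1 + z) / Gamma (1 + z)"
    using pochhammer_Gamma[OF nz', of m] by (simp add: algebra_simps)
  moreover have "Gamma (1 + z) \<noteq> 0" "Gamma (- z) \<noteq> 0"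
    using nz nz' by (auto simp: Gamma_eq_zero_iff)
  moreover have "- c * g * A / (r * B * D) = - (c * g / (r * E) * ((A / B) / (D / E)))"
    if "E \<noteq> 0" "B \<noteq> 0" for c g A r B D E :: real
    using that by simp
  ultimately show ?thesis
    using k unfolding frac_kernel_def laplace_kernel_def laplace_const_def pochhammer_ratio_def m m_def[symmetric]
    by simp
qed

lemma laplace_const_Suc:
  assumes "z \<ge> 0"
  shows "(z + 1) * laplace_const (z + 1) = (4 * z + 2) * laplace_const z"
proof -
  have "Gamma (1/2 + z + 1) = (1/2 + z) * Gamma (1/2 + z)" "Gamma (1 + z + 1) = (1 + z) * Gamma (1 + z)"
    using assms by (intro Gamma_plus1; auto elim!: nonpos_Ints_cases')+
  then have e: "Gamma (1/2 + (z + 1)) = (1/2 + z) * Gamma (1/2 + z)"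
      "Gamma (1 + (z + 1)) = (1 + z) * Gamma (1 + z)"
    by (simp_all only: add.assoc)
  have "(z + 1) * (4 powr z * 4 * ((1/2 + z) * g) / (r * ((1 + z) * h))) =
        (4 * z + 2) * (4 powr z * g / (r * h))" for g r h :: real
  proof -
    have "(z + 1) * (4 powr z * 4 * ((1/2 + z) * g) / (r * ((1 + z) * h))) =
          (z + 1) / (1 + z) * (4 powr z * (4 * (1/2 + z)) * g / (r * h))"
      by (simp only: times_divide_times_eq times_divide_eq_right divide_divide_eq_left mult_ac)
    moreover have "(z + 1) / (1 + z) = 1" using assms by simp
    ultimately show ?thesis by (simp add: algebra_simps)
  qed
  then show ?thesis
    unfolding laplace_const_def e by (simp add: powr_add)
qed

lemma laplace_const_0 [simp]: "laplace_const 0 = 1"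
  by (simp add: laplace_const_def Gamma_one_half_real)

lemma laplace_kernel_0: "laplace_kernel 0 k = of_bool (k = 0)"
proof (cases "k = 0")
  case False
  then obtain m where "nat \<bar>k\<bar> = Suc m"
    by (metis gr0_implies_Suc zero_less_abs_iff zero_less_nat_eq)
  then show ?thesis
    using False by (simp add: laplace_kernel_def pochhammer_ratio_def pochhammer_rec)
qed (simp add: laplace_kernel_def)

text \<open>
  Over the common denominator \<open>(1 + z)\<^sub>k\<^sub>+\<^sub>2\<close>, and with the common factor \<open>(-z)\<^sub>k\<close>
  taken out, this is a polynomial identity in \<open>k\<close> and \<open>z\<close>.
\<close>

lemma pochhammer_ratio_second_difference:
  assumes "z \<ge> 0"
  shows "(4 * z + 2) * pochhammer_ratio (z + 1) (Suc k) =
    (z + 1) * (2 * pochhammer_ratio z (Suc k) - pochhammer_ratio z k - pochhammer_ratio z (Suc (Suc k)))"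
proof -
  define p where "p = pochhammer (- z) k"
  define q where "q = pochhammer (2 + z) k"
  have q: "q > 0" unfolding q_def using assms by (intro pochhammer_pos) auto
  have p1: "pochhammer (- (z + 1)) (Suc k) = - (z + 1) * p"
    unfolding p_def by (subst pochhammer_rec) (simp add: algebra_simps)
  have q1: "pochhammer (1 + (z + 1)) (Suc k) = (2 + z + k) * q"
    unfolding q_def by (simp add: pochhammer_Suc algebra_simps)
  have q0: "pochhammer (1 + z) (Suc k) = (1 + z) * q"
    unfolding q_def by (subst pochhammer_rec) (simp add: algebra_simps)
  then have q0': "pochhammer (1 + z) k = (1 + z) * q / (1 + z + k)"
    using assms by (simp add: pochhammer_Suc field_simps)
  \<comment> \<open>With the common denominator abbreviated by its reciprocal, all four ratios become polynomials.\<close>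
  define i where "i = 1 / ((1 + z) * q * (2 + z + k))"
  have nz: "1 + z \<noteq> 0" "2 + z + k \<noteq> 0" "q \<noteq> 0" using assms q by auto
  have r1: "pochhammer_ratio (z + 1) (Suc k) = - (z + 1) * (z + 1) * p * i"
    unfolding pochhammer_ratio_def p1 q1 i_def using nz by (simp add: add.commute mult_ac)
  have r2: "pochhammer_ratio z k = p * (1 + z + k) * (2 + z + k) * i"
    unfolding pochhammer_ratio_def q0' p_def[symmetric] i_def using nz by (simp add: mult_ac)
  have r3: "pochhammer_ratio z (Suc k) = p * (k - z) * (2 + z + k) * i"
    unfolding pochhammer_ratio_def q0 i_def using nz by (simp add: pochhammer_Suc p_def mult_ac)
  have p2: "pochhammer (- z) (Suc (Suc k)) = p * (k - z) * (k + 1 - z)"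
    by (simp add: pochhammer_Suc p_def algebra_simps)
  have q2: "pochhammer (1 + z) (Suc (Suc k)) = (1 + z) * q * (2 + z + k)"
    unfolding pochhammer_Suc[of "1 + z" "Suc k"] q0 by (simp add: algebra_simps)
  have r4: "pochhammer_ratio z (Suc (Suc k)) = p * (k - z) * (k + 1 - z) * i"
    unfolding pochhammer_ratio_def p2 q2 i_def by simp
  show ?thesis
    unfolding r1 r2 r3 r4 by (simp add: algebra_simps)
qed

text \<open>
  The kernel at \<open>z + 1\<close> is \<open>-\<Delta>\<close> applied to the kernel at \<open>z\<close>, which reflects the factorization
  \<open>(2 - 2 cos \<theta>)\<^sup>z\<^sup>+\<^sup>1 = (2 - 2 cos \<theta>) (2 - 2 cos \<theta>)\<^sup>z\<close>. The case \<open>k = 0\<close> is special because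
  the kernel depends on \<open>\<bar>k\<bar>\<close>.
\<close>

lemma laplace_kernel_second_difference:
  assumes "z \<ge> 0"
  shows "laplace_kernel (z + 1) k =
           2 * laplace_kernel z k - laplace_kernel z (k - 1) - laplace_kernel z (k + 1)"
proof -
  have z1: "z + 1 \<noteq> 0" using assms by auto
  have main: "laplace_kernel (z + 1) (int m) =
      2 * laplace_kernel z (int m) - laplace_kernel z (int m - 1) - laplace_kernel z (int m + 1)" for m
  proof (cases m)
    case 0
    have "(1 + z) * pochhammer_ratio z 1 = - z"
      using pochhammer_ratio_Suc[OF assms, of 0] by simp
    then have "(z + 1) * (2 * laplace_const z - 2 * laplace_const z * pochhammer_ratio z 1) =
               (z + 1) * laplace_const (z + 1)"
      unfolding laplace_const_Suc[OF assms] by algebra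
    then show ?thesis
      using z1 0 by (simp add: laplace_kernel_def)
  next
    case (Suc k)
    have e: "nat \<bar>int m\<bar> = Suc k" "nat \<bar>int m - 1\<bar> = k" "nat \<bar>int m + 1\<bar> = Suc (Suc k)"
      using Suc by auto
    have "(z + 1) * ((4 * z + 2) * (laplace_const (z + 1) * pochhammer_ratio (z + 1) (Suc k))) =
      ((z + 1) * laplace_const (z + 1)) * ((4 * z + 2) * pochhammer_ratio (z + 1) (Suc k))"
      by algebra
    also have "\<dots> = (z + 1) * ((4 * z + 2) * (laplace_const z * (2 * pochhammer_ratio z (Suc k)
                      - pochhammer_ratio z k - pochhammer_ratio z (Suc (Suc k)))))"
      unfolding laplace_const_Suc[OF assms] pochhammer_ratio_second_difference[OF assms] by algebra
    finally have "laplace_const (z + 1) * pochhammer_ratio (z + 1) (Suc k) =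
       laplace_const z * (2 * pochhammer_ratio z (Suc k)
                      - pochhammer_ratio z k - pochhammer_ratio z (Suc (Suc k)))"
      using assms by simp
    then show ?thesis
      unfolding laplace_kernel_def e by (simp add: algebra_simps)
  qed
  show ?thesis
  proof (cases "k \<ge> 0")
    case True
    then show ?thesis using main[of "nat k"] by simp
  next
    case False
    have "laplace_kernel z (- k - 1) = laplace_kernel z (k + 1)"
         "laplace_kernel z (- k + 1) = laplace_kernel z (k - 1)"
      by (simp_all add: laplace_kernel_def abs_minus_commute add.commute)
    moreover have "laplace_kernel w (- k) = laplace_kernel w k" for w
      by (simp add: laplace_kernel_def)
    ultimately show ?thesis using False main[of "nat (- k)"] by simp
  qed
qed

section \<open>Summability\<close>

text \<open>
  The recurrence turns \<open>2 z p\<^sub>k\<close> into the difference \<open>(k + z) p\<^sub>k - (k + 1 + z) p\<^sub>k\<^sub>+\<^sub>1\<close>, where \<open>p\<^sub>k\<close>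
  is the ratio at \<open>k\<close>.
\<close>

lemma pochhammer_ratio_telescope:
  assumes "z > 0"
  shows "2 * z * (\<Sum>k<n. pochhammer_ratio z k) = z - (real n + z) * pochhammer_ratio z n"
proof (induction n)
  case (Suc n)
  have "2 * z * (\<Sum>k<Suc n. pochhammer_ratio z k) =
        z - (real n + z) * pochhammer_ratio z n + 2 * z * pochhammer_ratio z n"
    using Suc by (simp add: algebra_simps)
  also have "\<dots> = z - (real n - z) * pochhammer_ratio z n"
    by algebra
  also have "\<dots> = z - (real (Suc n) + z) * pochhammer_ratio z (Suc n)"
    using pochhammer_ratio_Suc[of z n] assms by (simp add: algebra_simps)
  finally show ?case .
qed simp

lemma abs_pochhammer_ratio_Suc:
  assumes "0 \<le> z" "z \<le> real k"
  shows "(real k + 1 + z) * \<bar>pochhammer_ratio z (Suc k)\<bar> = (real k - z) * \<bar>pochhammer_ratio z k\<bar>"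
  using arg_cong[OF pochhammer_ratio_Suc[OF assms(1), of k], of abs] assms by (simp only: abs_mult)

text \<open>
  Past \<open>k = z\<close> the ratios keep a constant sign, so their absolute values telescope as well: with
  \<open>T\<^sub>k = (k + z) \<bar>p\<^sub>k\<bar>\<close> one has \<open>2 z \<bar>p\<^sub>k\<bar> = T\<^sub>k - T\<^sub>k\<^sub>+\<^sub>1\<close>. So \<open>T\<close> decreases to a limit and the
  series converges. A positive limit of \<open>T\<close> would force \<open>\<bar>p\<^sub>k\<bar>\<close> to be at least of the order of
  \<open>1/k\<close>, contradicting this convergence.
\<close>

lemma summable_abs_pochhammer_ratio:
  assumes z: "z > 0"
  shows "summable (\<lambda>k. \<bar>pochhammer_ratio z k\<bar>)"
    and "(\<lambda>k. (real k + z) * \<bar>pochhammer_ratio z k\<bar>) \<longlonglongrightarrow> 0"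
proof -
  obtain N where N: "real N \<ge> z" using real_arch_simple by blast
  define T where "T = (\<lambda>n. (real (n + N) + z) * \<bar>pochhammer_ratio z (n + N)\<bar>)"
  have step: "2 * z * \<bar>pochhammer_ratio z (n + N)\<bar> = T n - T (Suc n)" for n
    using abs_pochhammer_ratio_Suc[of z "n + N"] z N by (simp add: T_def algebra_simps)
  have T0: "T n \<ge> 0" for n using z by (simp add: T_def)
  have "decseq T"
  proof (rule decseq_SucI)
    fix n have "0 \<le> 2 * z * \<bar>pochhammer_ratio z (n + N)\<bar>" using z by simp
    then show "T (Suc n) \<le> T n" unfolding step by simp
  qed
  then obtain L where L: "T \<longlonglongrightarrow> L" "\<And>n. L \<le> T n"
    using decseq_convergent[of T 0] T0 by auto
  have "L \<ge> 0" using L(1) T0 by (intro LIMSEQ_le_const) auto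
  have "(\<lambda>n. T n - T (Suc n)) sums (T 0 - L)"
    using telescope_sums'[OF L(1)] .
  then have "summable (\<lambda>n. 2 * z * \<bar>pochhammer_ratio z (n + N)\<bar>)"
    unfolding step by (simp add: sums_iff)
  then have sN: "summable (\<lambda>n. \<bar>pochhammer_ratio z (n + N)\<bar>)"
    using z by (simp add: summable_cmult_iff)
  then show "summable (\<lambda>k. \<bar>pochhammer_ratio z k\<bar>)"
    using summable_iff_shift by blast
  have "L = 0"
  proof (rule ccontr)
    assume "L \<noteq> 0"
    with \<open>L \<ge> 0\<close> have "L > 0" by simp
    \<comment> \<open>\<open>M\<close> is chosen so that \<open>n + N + z \<le> n + M\<close> and \<open>n + M\<close> is never \<open>0\<close>.\<close>
    define M where "M = Suc (2 * N)"
    have b: "norm (L * inverse (real (n + M))) \<le> \<bar>pochhammer_ratio z (n + N)\<bar>" for n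
    proof -
      have "L \<le> (real (n + N) + z) * \<bar>pochhammer_ratio z (n + N)\<bar>" using L(2)[of n] by (simp add: T_def)
      also have "\<dots> \<le> real (n + M) * \<bar>pochhammer_ratio z (n + N)\<bar>"
        using N by (intro mult_right_mono) (auto simp: M_def)
      finally show ?thesis using \<open>L > 0\<close>
        by (simp add: M_def field_simps del: of_nat_Suc of_nat_add)
    qed
    have "summable (\<lambda>n. L * inverse (real (n + M)))"
      by (rule summable_comparison_test'[OF sN, of 0]) (use b in auto)
    then have "summable (\<lambda>n. inverse (real (n + M)))"
      using \<open>L > 0\<close> by (simp add: summable_cmult_iff)
    then have "summable (\<lambda>n. inverse (real n))"
      using summable_iff_shift[of "\<lambda>n. inverse (real n)" M] by simp
    then show False using not_summable_harmonic by blast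
  qed
  with L(1) have "T \<longlonglongrightarrow> 0" by simp
  then show "(\<lambda>k. (real k + z) * \<bar>pochhammer_ratio z k\<bar>) \<longlonglongrightarrow> 0"
    unfolding T_def by (rule LIMSEQ_offset)
qed

lemma pochhammer_ratio_sums_half:
  assumes z: "z > 0"
  shows "pochhammer_ratio z sums (1/2)"
proof -
  have "(\<lambda>n. \<bar>(real n + z) * pochhammer_ratio z n\<bar>) \<longlonglongrightarrow> 0"
    using summable_abs_pochhammer_ratio(2)[OF z] z by (simp add: abs_mult)
  then have "(\<lambda>n. (real n + z) * pochhammer_ratio z n) \<longlonglongrightarrow> 0"
    by (rule tendsto_rabs_zero_cancel)
  then have "(\<lambda>n. (z - (real n + z) * pochhammer_ratio z n) / (2 * z)) \<longlonglongrightarrow> (z - 0) / (2 * z)"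
    using z by (intro tendsto_intros) auto
  moreover have "(z - (real n + z) * pochhammer_ratio z n) / (2 * z) = (\<Sum>k<n. pochhammer_ratio z k)" for n
    using z by (simp flip: pochhammer_ratio_telescope)
  ultimately show ?thesis
    using z by (simp add: sums_def)
qed

text \<open>
  The sum is the value of \<open>(2 - 2 cos \<theta>)\<^sup>z\<close> at \<open>\<theta> = 0\<close>. Concretely, the ratios for \<open>k \<ge> 0\<close> sum to
  \<open>1/2\<close>, and doubling this counts the ratio \<open>1\<close> at \<open>k = 0\<close> once too often.
\<close>

lemma has_sum_laplace_kernel:
  assumes z: "z > 0"
  shows "(laplace_kernel z has_sum 0) UNIV"
proof -
  have "(pochhammer_ratio z has_sum (1/2)) UNIV"
    by (rule norm_summable_imp_has_sum)
       (use summable_abs_pochhammer_ratio(1)[OF z] pochhammer_ratio_sums_half[OF z] in auto)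
  from has_sum_cmult_right[OF has_sum_int_even[OF this], of "laplace_const z"]
  show ?thesis
    by (simp add: laplace_kernel_def[abs_def])
qed

lemma summable_on_laplace_kernel:
  assumes "z \<ge> 0"
  shows "laplace_kernel z summable_on UNIV"
proof (cases "z = 0")
  case True
  have "{k. laplace_kernel 0 k \<noteq> 0} \<subseteq> {0}" by (auto simp: laplace_kernel_0)
  then show ?thesis
    unfolding True by (intro finite_nonzero_values_imp_summable_on) (auto intro: finite_subset)
next
  case False
  then show ?thesis using assms by (intro has_sum_imp_summable[OF has_sum_laplace_kernel]) auto
qed

section \<open>Continuity\<close>

lemma isCont_laplace_kernel:
  assumes "s > 0"
  shows "isCont (\<lambda>z. laplace_kernel z k) s"
proof -
  have np: "1/2 + s \<notin> \<int>\<^sub>\<le>\<^sub>0" "1 + s \<notin> \<int>\<^sub>\<le>\<^sub>0"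
    using assms by (auto elim!: nonpos_Ints_cases')
  have G: "isCont (\<lambda>z. Gamma (1/2 + z)) s" "isCont (\<lambda>z. Gamma (1 + z)) s"
    unfolding isCont_def using np by (intro tendsto_Gamma tendsto_intros; simp)+
  have p: "isCont (\<lambda>z. pochhammer (- z) n) s" "isCont (\<lambda>z. pochhammer (1 + z) n) s" for n
    by (induction n) (auto simp: pochhammer_Suc intro!: continuous_intros)
  have nz: "pochhammer (1 + s) (nat \<bar>k\<bar>) \<noteq> 0" "sqrt pi * Gamma (1 + s) \<noteq> 0"
    using assms pochhammer_pos[of "1 + s" "nat \<bar>k\<bar>"] Gamma_real_pos[of "1 + s"] by (auto simp: less_le)
  have c: "isCont (\<lambda>z. 4 powr z) s"
    by (intro continuous_intros) auto
  show ?thesis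
    unfolding laplace_kernel_def laplace_const_def pochhammer_ratio_def
    by (intro continuous_mult continuous_at_within_divide continuous_const G p c nz)
qed

lemma pochhammer_ratio_nonzero:
  assumes "0 < a" "a < 1"
  shows "pochhammer_ratio a k \<noteq> 0"
proof (induction k)
  case (Suc k)
  have "real k \<noteq> a" using assms by (cases k) auto
  then show ?case
    using Suc pochhammer_ratio_Suc[of a k] assms by auto
qed simp

text \<open>
  The quotient \<open>(k - z) / (k + 1 + z)\<close> of consecutive values decreases in \<open>z\<close>. Hence, beyond an index
  \<open>N \<ge> s + 1\<close>, the kernel at any \<open>z\<close> between \<open>a\<close> and \<open>s + 1\<close> decays at least as fast as the ratios at
  \<open>a\<close>, and the finitely many values up to \<open>N\<close> are controlled by continuity in \<open>z\<close>. Taking \<open>a < 1\<close>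
  ensures that the ratios at \<open>a\<close> do not vanish, so that one can compare with them.
\<close>

lemma laplace_kernel_locally_dominated:
  assumes a: "0 < a" "a < 1" "a < s"
  shows "\<exists>C\<ge>0. \<forall>\<^sub>F z in nhds s. \<forall>k. \<bar>laplace_kernel z k\<bar> \<le> C * \<bar>pochhammer_ratio a (nat \<bar>k\<bar>)\<bar>"
proof -
  obtain N where N: "real N \<ge> s + 1" using real_arch_simple by blast
  define C where "C = (\<Sum>k\<le>N. (1 + \<bar>laplace_kernel s (int k)\<bar>) / \<bar>pochhammer_ratio a k\<bar>)"
  have "\<forall>\<^sub>F z in nhds s. \<bar>laplace_kernel z (int k)\<bar> < 1 + \<bar>laplace_kernel s (int k)\<bar>" for k
  proof -
    have "((\<lambda>z. \<bar>laplace_kernel z (int k)\<bar>) \<longlongrightarrow> \<bar>laplace_kernel s (int k)\<bar>) (nhds s)"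
      using isCont_laplace_kernel[of s "int k"] a unfolding isCont_def
      by (intro tendsto_rabs tendsto_at_iff_tendsto_nhds[THEN iffD1]) auto
    then show ?thesis by (rule order_tendstoD) simp
  qed
  then have "\<forall>\<^sub>F z in nhds s. \<forall>k\<in>{..N}. \<bar>laplace_kernel z (int k)\<bar> < 1 + \<bar>laplace_kernel s (int k)\<bar>"
    by (intro eventually_ball_finite) auto
  moreover have "\<forall>\<^sub>F z in nhds s. z \<in> {a<..<s + 1}"
    using a by (intro eventually_nhds_in_open) auto
  ultimately have "\<forall>\<^sub>F z in nhds s. \<forall>k. \<bar>laplace_kernel z k\<bar> \<le> C * \<bar>pochhammer_ratio a (nat \<bar>k\<bar>)\<bar>"
  proof eventually_elim
    case (elim z)
    have z: "a < z" "z < s + 1" using elim by auto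
    have small: "\<bar>laplace_kernel z (int k)\<bar> \<le> C * \<bar>pochhammer_ratio a k\<bar>" if "k \<le> N" for k
    proof -
      have "(1 + \<bar>laplace_kernel s (int k)\<bar>) / \<bar>pochhammer_ratio a k\<bar> \<le> C"
        unfolding C_def using that by (intro member_le_sum) auto
      then have "1 + \<bar>laplace_kernel s (int k)\<bar> \<le> C * \<bar>pochhammer_ratio a k\<bar>"
        using pochhammer_ratio_nonzero[OF a(1,2), of k] by (simp add: field_simps)
      moreover have "\<bar>laplace_kernel z (int k)\<bar> < 1 + \<bar>laplace_kernel s (int k)\<bar>"
        using elim that by auto
      ultimately show ?thesis by linarith
    qed
    have large: "\<bar>laplace_kernel z (int k)\<bar> \<le> C * \<bar>pochhammer_ratio a k\<bar>" if "k \<ge> N" for k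
      using that
    proof (induction k rule: dec_induct)
      case base
      then show ?case by (intro small) auto
    next
      case (step k)
      have C: "C \<ge> 0" unfolding C_def by (intro sum_nonneg) auto
      have kz: "real k \<ge> z" using N step z by linarith
      have abs_ratio: "\<bar>pochhammer_ratio w (Suc k)\<bar> = (k - w) / (real k + 1 + w) * \<bar>pochhammer_ratio w k\<bar>"
        if "0 \<le> w" "w \<le> k" for w :: real
      proof -
        have "real k + 1 + w > 0" using that by simp
        then show ?thesis
          using abs_pochhammer_ratio_Suc[OF that] by (metis less_irrefl nonzero_eq_divide_eq times_divide_eq_left mult.commute)
      qed
      have 1: "\<bar>laplace_kernel z (int (Suc k))\<bar> = (k - z) / (real k + 1 + z) * \<bar>laplace_kernel z (int k)\<bar>"
        using abs_ratio[of z] a z kz by (simp add: laplace_kernel_def abs_mult nat_add_distrib)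
      have 2: "\<bar>pochhammer_ratio a (Suc k)\<bar> = (k - a) / (real k + 1 + a) * \<bar>pochhammer_ratio a k\<bar>"
        using abs_ratio[of a] a z kz by simp
      have "\<bar>laplace_kernel z (int (Suc k))\<bar> \<le> (k - a) / (real k + 1 + a) * (C * \<bar>pochhammer_ratio a k\<bar>)"
        unfolding 1 using step(3) z a kz C by (intro mult_mono frac_le) auto
      then show ?case unfolding 2 by (simp add: mult_ac)
    qed
    show ?case
    proof
      fix k
      have "laplace_kernel z k = laplace_kernel z (int (nat \<bar>k\<bar>))" by (simp add: laplace_kernel_def)
      then show "\<bar>laplace_kernel z k\<bar> \<le> C * \<bar>pochhammer_ratio a (nat \<bar>k\<bar>)\<bar>"
        using small[of "nat \<bar>k\<bar>"] large[of "nat \<bar>k\<bar>"] by (metis nle_le)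
    qed
  qed
  moreover have "C \<ge> 0" unfolding C_def by (intro sum_nonneg) auto
  ultimately show ?thesis by blast
qed

section \<open>Convolution with a summable kernel\<close>

definition convolve :: "(int \<Rightarrow> real) \<Rightarrow> (int \<Rightarrow> real) \<Rightarrow> int \<Rightarrow> real" where
  "convolve a u n = (\<Sum>\<^sub>\<infinity>k. a (n - k) * u k)"

lemma ell2_imp_bounded:
  assumes "u \<in> ell2"
  shows "bounded (range u)"
proof -
  define S where "S = (\<Sum>\<^sub>\<infinity>k. \<bar>u k\<bar>\<^sup>2)"
  have "\<bar>u k\<bar> \<le> 1 + S" for k
  proof -
    have "sum (\<lambda>k. \<bar>u k\<bar>\<^sup>2) {k} \<le> S"
      unfolding S_def using assms by (intro finite_sum_le_infsum) (auto simp: ell2_def)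
    moreover have "2 * \<bar>u k\<bar> \<le> 1 + \<bar>u k\<bar>\<^sup>2" using zero_le_power2[of "\<bar>u k\<bar> - 1"]
      by (simp add: power2_diff)
    ultimately show ?thesis by simp
  qed
  then show ?thesis by (auto simp: bounded_iff)
qed

lemma bounded_neg_laplace:
  assumes "bounded (range u)"
  shows "bounded (range (\<lambda>m. - discrete_laplace u m))"
proof -
  obtain B where B: "\<And>k. \<bar>u k\<bar> \<le> B" using assms by (auto simp: bounded_iff)
  have "\<bar>- discrete_laplace u m\<bar> \<le> 4 * B" for m
    using B[of m] B[of "m - 1"] B[of "m + 1"] unfolding discrete_laplace_def by linarith
  then show ?thesis by (auto simp: bounded_iff)
qed

lemma neg_laplace_pow_Suc:
  "neg_laplace_pow (Suc m) u = neg_laplace_pow m (\<lambda>n. - discrete_laplace u n)"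
  by (simp add: neg_laplace_pow_def funpow_Suc_right del: funpow.simps)

lemma bounded_neg_laplace_pow: "bounded (range u) \<Longrightarrow> bounded (range (neg_laplace_pow m u))"
proof (induction m arbitrary: u)
  case (Suc m)
  then show ?case unfolding neg_laplace_pow_Suc by (intro Suc.IH bounded_neg_laplace)
qed (simp add: neg_laplace_pow_def)

lemma summable_on_convolve:
  fixes a u :: "int \<Rightarrow> real"
  assumes "a summable_on UNIV" "bounded (range u)"
  shows "(\<lambda>k. a (n - k) * u k) summable_on UNIV"
  using assms by (intro summable_on_mult_bounded) (auto simp: summable_on_reflect)

lemma bounded_shift: "bounded (range u) \<Longrightarrow> bounded (range (\<lambda>k. u (k + c)))"
  by (rule bounded_subset) auto

lemma convolve_shift:
  "(\<Sum>\<^sub>\<infinity>k. a (n - k) * u (k + c)) = convolve (\<lambda>k. a (k + c)) u n"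
proof -
  have "bij (\<lambda>k::int. k + c)" by (rule bij_betwI[where g = "\<lambda>k. k - c"]) auto
  from infsum_reindex_bij_betw[OF this, of "\<lambda>k. a (n - k + c) * u k"] show ?thesis
    by (simp add: convolve_def algebra_simps)
qed

text \<open>
  Summation by parts: \<open>-\<Delta>\<close> can be moved from the kernel to the sequence.
\<close>

lemma convolve_second_difference:
  assumes a: "a summable_on UNIV" and u: "bounded (range u)"
  shows "convolve (\<lambda>k. 2 * a k - a (k - 1) - a (k + 1)) u n =
         convolve a (\<lambda>m. - discrete_laplace u m) n"
proof -
  have sa: "(\<lambda>k. a (k + c)) summable_on UNIV" for c
  proof -
    have "bij (\<lambda>k::int. k + c)" by (rule bij_betwI[where g = "\<lambda>k. k - c"]) auto
    from summable_on_reindex_bij_betw[OF this, of a] show ?thesis using a by simp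
  qed
  have s1: "(\<lambda>k. a (n - k + c) * u k) summable_on UNIV" for c
    using summable_on_convolve[OF sa u] .
  have s2: "(\<lambda>k. a (n - k) * u (k + c)) summable_on UNIV" for c
    using summable_on_convolve[OF a bounded_shift[OF u]] .
  have infsum_diff: "(\<Sum>\<^sub>\<infinity>k. 2 * f k - g k - h k) = 2 * infsum f UNIV - infsum g UNIV - infsum h UNIV"
    if "f summable_on UNIV" "g summable_on UNIV" "h summable_on UNIV" for f g h :: "int \<Rightarrow> real"
    using that by (intro infsumI has_sum_diff has_sum_cmult_right has_sum_infsum)
  have "convolve (\<lambda>k. 2 * a k - a (k - 1) - a (k + 1)) u n =
    (\<Sum>\<^sub>\<infinity>k. 2 * (a (n - k + 0) * u k) - a (n - k + (-1)) * u k - a (n - k + 1) * u k)"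
    unfolding convolve_def by (intro infsum_cong) (simp add: algebra_simps)
  also have "\<dots> = 2 * convolve (\<lambda>k. a (k + 0)) u n - convolve (\<lambda>k. a (k + (-1))) u n
                  - convolve (\<lambda>k. a (k + 1)) u n"
    unfolding convolve_def
    by (rule infsum_diff[OF s1 s1 s1])
  also have "\<dots> = (\<Sum>\<^sub>\<infinity>k. 2 * (a (n - k) * u (k + 0)) - a (n - k) * u (k + (-1)) - a (n - k) * u (k + 1))"
    unfolding convolve_shift[symmetric]
    by (rule infsum_diff[OF s2 s2 s2, symmetric])
  also have "\<dots> = convolve a (\<lambda>m. - discrete_laplace u m) n"
    unfolding convolve_def discrete_laplace_def by (intro infsum_cong) (simp add: algebra_simps)
  finally show ?thesis .
qed

lemma convolve_laplace_kernel_add_nat: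
  assumes z: "z \<ge> 0" and u: "bounded (range u)"
  shows "convolve (laplace_kernel (z + real m)) u n = convolve (laplace_kernel z) (neg_laplace_pow m u) n"
  using u
proof (induction m arbitrary: u)
  case 0
  then show ?case by (simp add: neg_laplace_pow_def)
next
  case (Suc m)
  have "laplace_kernel (z + real (Suc m)) =
    (\<lambda>k. 2 * laplace_kernel (z + m) k - laplace_kernel (z + m) (k - 1) - laplace_kernel (z + m) (k + 1))"
    using laplace_kernel_second_difference[of "z + m"] z by (auto simp: algebra_simps)
  then have "convolve (laplace_kernel (z + real (Suc m))) u n =
        convolve (laplace_kernel (z + m)) (\<lambda>n. - discrete_laplace u n) n"
    using z Suc.prems by (simp only: convolve_second_difference summable_on_laplace_kernel
        add_nonneg_nonneg of_nat_0_le_iff)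
  then show ?case
    using Suc.IH[OF bounded_neg_laplace[OF Suc.prems]] by (simp only: neg_laplace_pow_Suc)
qed

lemma convolve_laplace_kernel_of_nat:
  assumes "bounded (range u)"
  shows "convolve (laplace_kernel (real m)) u n = neg_laplace_pow m u n"
proof -
  have "convolve (laplace_kernel (real m)) u n = convolve (laplace_kernel 0) (neg_laplace_pow m u) n"
    using convolve_laplace_kernel_add_nat[of 0 u m n] assms by simp
  also have "\<dots> = (\<Sum>\<^sub>\<infinity>k\<in>{n}. laplace_kernel 0 (n - k) * neg_laplace_pow m u k)"
    unfolding convolve_def by (rule infsum_cong_neutral) (auto simp: laplace_kernel_0)
  also have "\<dots> = neg_laplace_pow m u n"
    by (simp add: laplace_kernel_0)
  finally show ?thesis .
qed

text \<open>
  The terms containing \<open>u n\<close> cancel because the kernel sums to \<open>0\<close>.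
\<close>

lemma convolve_laplace_kernel_differences:
  assumes z: "z > 0" and u: "bounded (range u)"
  shows "(\<Sum>\<^sub>\<infinity>k. laplace_kernel z (n - k) * (u k - u n)) = convolve (laplace_kernel z) u n"
proof -
  have s: "(\<lambda>k. laplace_kernel z (n - k)) summable_on UNIV"
    using summable_on_laplace_kernel[OF less_imp_le[OF z]] by (simp add: summable_on_reflect)
  have "(\<Sum>\<^sub>\<infinity>k. laplace_kernel z (n - k) * (u k - u n)) =
        (\<Sum>\<^sub>\<infinity>k. laplace_kernel z (n - k) * u k - laplace_kernel z (n - k) * u n)"
    by (simp add: algebra_simps)
  also have "\<dots> = convolve (laplace_kernel z) u n - (\<Sum>\<^sub>\<infinity>k. laplace_kernel z (n - k) * u n)"
    unfolding convolve_def using summable_on_convolve[OF summable_on_laplace_kernel[OF less_imp_le[OF z]] u] s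
    by (intro infsumI has_sum_diff has_sum_infsum summable_on_cmult_left) auto
  also have "(\<Sum>\<^sub>\<infinity>k. laplace_kernel z (n - k) * u n) = 0"
    using infsumI[OF has_sum_laplace_kernel[OF z]] s by (simp add: infsum_cmult_left infsum_reflect)
  finally show ?thesis by simp
qed

lemma infsum_frac_kernel_eq_convolve:
  assumes z: "z > 0" "z \<notin> \<nat>" and u: "bounded (range u)"
  shows "(\<Sum>\<^sub>\<infinity>k. frac_kernel z (n - k) * (u n - u k)) = convolve (laplace_kernel z) u n"
proof -
  have "frac_kernel z (n - k) * (u n - u k) = laplace_kernel z (n - k) * (u k - u n)" for k
    using frac_kernel_eq_laplace_kernel[OF z, of "n - k"] by (cases "k = n") (auto simp: algebra_simps)
  then show ?thesis
    using convolve_laplace_kernel_differences[OF z(1) u] by simp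
qed

lemma tendsto_convolve_laplace_kernel:
  assumes s: "s > 0" and u: "bounded (range u)"
  shows "((\<lambda>z. convolve (laplace_kernel z) u n) \<longlongrightarrow> convolve (laplace_kernel s) u n) (nhds s)"
proof -
  obtain B where B: "\<And>k. \<bar>u k\<bar> \<le> B" using u by (auto simp: bounded_iff)
  \<comment> \<open>Any positive \<open>a\<close> below both \<open>1\<close> and \<open>s\<close> would do.\<close>
  define a where "a = min (1/2) (s/2)"
  have a: "0 < a" "a < 1" "a < s" using s by (auto simp: a_def)
  obtain C where C: "C \<ge> 0"
    and dom: "\<forall>\<^sub>F z in nhds s. \<forall>k. \<bar>laplace_kernel z k\<bar> \<le> C * \<bar>pochhammer_ratio a (nat \<bar>k\<bar>)\<bar>"
    using laplace_kernel_locally_dominated[OF a] by blast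
  define M where "M = (\<lambda>k. C * \<bar>pochhammer_ratio a (nat \<bar>n - k\<bar>)\<bar> * B)"
  have "(\<lambda>k. \<bar>pochhammer_ratio a k\<bar>) summable_on UNIV"
    using summable_abs_pochhammer_ratio(1)[OF a(1)] by (intro norm_summable_imp_summable_on) simp
  then have "(\<lambda>k::int. \<bar>pochhammer_ratio a (nat \<bar>k\<bar>)\<bar>) summable_on UNIV"
    using has_sum_int_even by (auto simp: summable_on_def)
  then have "(\<lambda>k::int. \<bar>pochhammer_ratio a (nat \<bar>n - k\<bar>)\<bar>) summable_on UNIV"
    by (rule summable_on_reflect[THEN iffD2])
  then have "M summable_on UNIV"
    unfolding M_def by (intro summable_on_cmult_left summable_on_cmult_right)
  then have M: "summable (\<lambda>i. \<bar>M (int_decode i)\<bar>)"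
    by (rule infsum_int_eq_suminf)
  have conv: "convolve (laplace_kernel z) u n =
      (\<Sum>i. laplace_kernel z (n - int_decode i) * u (int_decode i))" if "z > 0" for z
    unfolding convolve_def
    by (rule infsum_int_eq_suminf(1)[OF summable_on_convolve[OF summable_on_laplace_kernel[OF less_imp_le[OF that]] u]])
  have "((\<lambda>z. \<Sum>i. laplace_kernel z (n - int_decode i) * u (int_decode i)) \<longlongrightarrow>
         (\<Sum>i. laplace_kernel s (n - int_decode i) * u (int_decode i))) (nhds s)"
  proof (rule tannerys_theorem[THEN conjunct2, THEN conjunct2])
    show "((\<lambda>z. laplace_kernel z (n - int_decode i) * u (int_decode i)) \<longlongrightarrow>
           laplace_kernel s (n - int_decode i) * u (int_decode i)) (nhds s)" for i
      using isCont_laplace_kernel[OF s] unfolding isCont_def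
      by (intro tendsto_mult tendsto_const tendsto_at_iff_tendsto_nhds[THEN iffD1]) auto
    have "\<forall>\<^sub>F z in nhds s. \<forall>i. norm (laplace_kernel z (n - int_decode i) * u (int_decode i))
            \<le> \<bar>M (int_decode i)\<bar>"
      using dom
    proof eventually_elim
      case (elim z)
      show ?case
      proof
        fix i
        have "norm (laplace_kernel z (n - int_decode i) * u (int_decode i)) \<le> M (int_decode i)"
          unfolding M_def using elim B C by (auto simp: abs_mult intro!: mult_mono)
        then show "norm (laplace_kernel z (n - int_decode i) * u (int_decode i)) \<le> \<bar>M (int_decode i)\<bar>"
          by linarith
      qed
    qed
    then show "\<forall>\<^sub>F (i, z) in at_top \<times>\<^sub>F nhds s. norm (laplace_kernel z (n - int_decode i) * u (int_decode i))
            \<le> \<bar>M (int_decode i)\<bar>"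
      unfolding eventually_prod_filter
      by (intro exI[of _ "\<lambda>_. True"] exI conjI) auto
  qed (use M in auto)
  then show ?thesis
    unfolding conv[OF s]
  proof (rule Lim_transform_eventually)
    have "\<forall>\<^sub>F z in nhds s. z \<in> {0<..}" using s by (intro eventually_nhds_in_open) auto
    then show "\<forall>\<^sub>F z in nhds s. (\<Sum>i. laplace_kernel z (n - int_decode i) * u (int_decode i)) =
        convolve (laplace_kernel z) u n"
      by eventually_elim (simp add: conv)
  qed
qed

section \<open>Gauss's summation theorem\<close>

lemma sums_of_suminf_ennreal:
  assumes "\<And>j. 0 \<le> f j" "(\<Sum>j. ennreal (f j)) = ennreal r" "0 \<le> r"
  shows "f sums r"
proof -
  have "summable f"
    using assms by (intro summable_suminf_not_top) auto
  then have "(\<Sum>j. ennreal (f j)) = ennreal (suminf f)"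
    by (intro suminf_ennreal_eq assms(1)) (rule summable_sums)
  then have "ennreal (suminf f) = ennreal r"
    unfolding assms(2) by (rule sym)
  then have "suminf f = r"
    using suminf_nonneg[OF \<open>summable f\<close> assms(1)] assms(3) by (simp only: ennreal_inj)
  then show ?thesis using \<open>summable f\<close> by (simp add: sums_iff)
qed

text \<open>
  The binomial series for the exponent \<open>-a\<close>, with its coefficients \<open>(a)\<^sub>j / j!\<close> multiplied by
  \<open>\<Gamma>(a)\<close>.
\<close>

lemma Gamma_binomial_series:
  fixes a x :: real
  assumes "a > 0" "\<bar>x\<bar> < 1"
  shows "(\<lambda>j. Gamma (a + real j) / fact j * x ^ j) sums (Gamma a * (1 - x) powr (- a))"
proof -
  have "Gamma (a + real j) / fact j * x ^ j = Gamma a * ((- a gchoose j) * (- x) ^ j)" for j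
  proof -
    have "pochhammer a j = Gamma (a + real j) / Gamma a"
      using assms by (intro pochhammer_Gamma) (auto elim!: nonpos_Ints_cases')
    then have "Gamma (a + real j) = Gamma a * pochhammer a j"
      using Gamma_real_pos[OF assms(1)] by simp
    moreover have "(- 1) ^ j * (- x) ^ j = x ^ j"
      by (simp flip: power_mult_distrib)
    ultimately show ?thesis
      by (simp add: gbinomial_pochhammer)
  qed
  then show ?thesis
    using sums_mult[OF gen_binomial_real[of "- x" "- a"], of "Gamma a"] assms by simp
qed

lemma nn_integral_Beta:
  fixes a b :: real
  assumes "a > 0" "b > 0"
  shows "(\<integral>\<^sup>+x. ennreal (indicator {0<..<1} x * (x powr (a - 1) * (1 - x) powr (b - 1))) \<partial>lborel) = Beta a b"
  by (rule nn_integral_has_integral_lebesgue[OF _ has_integral_Beta_real[OF assms, unfolded has_integral_Icc_iff_Ioo]])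
     simp

text \<open>
  Gauss's evaluation of the hypergeometric function \<open>F(a, b; c; 1)\<close>, multiplied by
  \<open>\<Gamma>(a) \<Gamma>(b) / \<Gamma>(c)\<close>. By Euler's method: \<open>\<Gamma>(b + j) \<Gamma>(c - b) / \<Gamma>(c + j)\<close> is the Beta integral of
  \<open>x\<^sup>b\<^sup>+\<^sup>j\<^sup>-\<^sup>1 (1 - x)\<^sup>c\<^sup>-\<^sup>b\<^sup>-\<^sup>1\<close>. Summing the binomial series in \<open>x\<close> under the integral sign contributes
  the factor \<open>(1 - x)\<^sup>-\<^sup>a\<close> and leaves another Beta integral. As all terms are nonnegative for positive
  parameters, monotone convergence justifies the exchange.
\<close>

theorem Gauss_hypergeometric_sums:
  fixes a b c :: real
  assumes a: "a > 0" and b: "b > 0" and c: "c > a + b"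
  shows "(\<lambda>j. Gamma (a + real j) * Gamma (b + real j) / (fact j * Gamma (c + real j))) sums
         (Gamma a * Gamma b * Gamma (c - a - b) / (Gamma (c - a) * Gamma (c - b)))"
proof -
  define d where "d = c - b"
  have d: "d > a" "d > 0" "c = b + d" using a b c by (auto simp: d_def)
  define w where "w = (\<lambda>j. Gamma (a + real j) / fact j)"
  have w: "w j \<ge> 0" for j using a by (simp add: w_def)
  have BN: "Beta p q \<ge> 0" if "p > 0" "q > 0" for p q :: real
    using that by (simp add: Beta_def)
  have scaled: "(\<integral>\<^sup>+x. ennreal u * ennreal (indicator {0<..<1} x * (x powr (p - 1) * (1 - x) powr (q - 1))) \<partial>lborel)
      = ennreal (u * Beta p q)" if "u \<ge> 0" "p > 0" "q > 0" for u p q :: real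
  proof -
    have "(\<integral>\<^sup>+x. ennreal u * ennreal (indicator {0<..<1} x * (x powr (p - 1) * (1 - x) powr (q - 1))) \<partial>lborel)
      = ennreal u * (\<integral>\<^sup>+x. ennreal (indicator {0<..<1} x * (x powr (p - 1) * (1 - x) powr (q - 1))) \<partial>lborel)"
      by (rule nn_integral_cmult) measurable
    then show ?thesis
      using that by (simp only: nn_integral_Beta ennreal_mult')
  qed
  have "(\<Sum>j. ennreal (w j * Beta (b + real j) d)) =
     (\<Sum>j. \<integral>\<^sup>+x. ennreal (w j) * ennreal (indicator {0<..<1} x * (x powr (b + real j - 1) * (1 - x) powr (d - 1))) \<partial>lborel)"
    using b d w by (subst scaled) auto
  also have "\<dots> = (\<integral>\<^sup>+x. (\<Sum>j. ennreal (w j) * ennreal (indicator {0<..<1} x * (x powr (b + real j - 1) * (1 - x) powr (d - 1)))) \<partial>lborel)"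
    by (rule nn_integral_suminf[symmetric]) measurable
  also have "\<dots> = (\<integral>\<^sup>+x. ennreal (Gamma a) * ennreal (indicator {0<..<1} x * (x powr (b - 1) * (1 - x) powr (d - a - 1))) \<partial>lborel)"
  proof (rule nn_integral_cong)
    fix x :: real
    show "(\<Sum>j. ennreal (w j) * ennreal (indicator {0<..<1} x * (x powr (b + real j - 1) * (1 - x) powr (d - 1)))) =
      ennreal (Gamma a) * ennreal (indicator {0<..<1} x * (x powr (b - 1) * (1 - x) powr (d - a - 1)))"
    proof (cases "x \<in> {0<..<1}")
      case True
      have "(\<lambda>j. (w j * x ^ j) * (x powr (b - 1) * (1 - x) powr (d - 1))) sums
            ((Gamma a * (1 - x) powr (- a)) * (x powr (b - 1) * (1 - x) powr (d - 1)))"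
        unfolding w_def using True by (intro sums_mult2 Gamma_binomial_series a) auto
      also have "(\<lambda>j. (w j * x ^ j) * (x powr (b - 1) * (1 - x) powr (d - 1))) =
                 (\<lambda>j. w j * (x powr (b + real j - 1) * (1 - x) powr (d - 1)))"
        using True by (auto simp: powr_add powr_diff powr_realpow)
      also have "(Gamma a * (1 - x) powr (- a)) * (x powr (b - 1) * (1 - x) powr (d - 1)) =
                 Gamma a * (x powr (b - 1) * (1 - x) powr (d - a - 1))"
      proof -
        have "(1 - x) powr (- a) * (1 - x) powr (d - 1) = (1 - x) powr (d - a - 1)"
          by (simp flip: powr_add add: algebra_simps)
        then show ?thesis by (metis mult.assoc mult.left_commute)
      qed
      finally have "(\<Sum>j. ennreal (w j * (x powr (b + real j - 1) * (1 - x) powr (d - 1)))) =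
          ennreal (Gamma a * (x powr (b - 1) * (1 - x) powr (d - a - 1)))"
        using w by (intro suminf_ennreal_eq) auto
      then show ?thesis using True w a by (simp add: ennreal_mult')
    qed simp
  qed
  also have "\<dots> = ennreal (Gamma a * Beta b (d - a))"
    using a b d by (intro scaled) auto
  finally have "(\<lambda>j. w j * Beta (b + real j) d) sums (Gamma a * Beta b (d - a))"
    using a b d w by (intro sums_of_suminf_ennreal) (auto intro!: mult_nonneg_nonneg BN)
  then have "(\<lambda>j. w j * Beta (b + real j) d / Gamma d) sums (Gamma a * Beta b (d - a) / Gamma d)"
    by (rule sums_divide)
  moreover have "w j * Beta (b + real j) d / Gamma d =
      Gamma (a + real j) * Gamma (b + real j) / (fact j * Gamma (c + real j))" for j
    using Gamma_real_pos[OF d(2)] by (simp add: w_def Beta_def d(3) add_ac)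
  moreover have "Gamma a * Beta b (d - a) / Gamma d =
      Gamma a * Gamma b * Gamma (c - a - b) / (Gamma (c - a) * Gamma (c - b))"
    by (simp add: Beta_def d(3) algebra_simps)
  ultimately show ?thesis by simp
qed

lemma Gamma_legendre_duplication_real:
  fixes x :: real
  assumes "x > 0"
  shows "Gamma x * Gamma (x + 1/2) = 2 powr (1 - 2 * x) * sqrt pi * Gamma (2 * x)"
proof -
  have "complex_of_real x \<notin> \<int>\<^sub>\<le>\<^sub>0" "complex_of_real (x + 1/2) \<notin> \<int>\<^sub>\<le>\<^sub>0"
    using assms by (auto simp del: of_real_add elim!: nonpos_Ints_cases' dest!: arg_cong[of _ _ Re])
  then have "Gamma (complex_of_real x) * Gamma (complex_of_real (x + 1/2)) =
     exp ((1 - 2 * complex_of_real x) * of_real (ln 2)) * of_real (sqrt pi) * Gamma (2 * complex_of_real x)"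
    using Gamma_legendre_duplication[of "complex_of_real x"] by simp
  also have "\<dots> = complex_of_real (exp ((1 - 2 * x) * ln 2) * sqrt pi * Gamma (2 * x))"
    by (simp flip: Gamma_complex_of_real exp_of_real)
  also have "Gamma (complex_of_real x) * Gamma (complex_of_real (x + 1/2)) =
      complex_of_real (Gamma x * Gamma (x + 1/2))"
    by (simp only: Gamma_complex_of_real of_real_mult)
  finally have "Gamma x * Gamma (x + 1/2) = exp ((1 - 2 * x) * ln 2) * sqrt pi * Gamma (2 * x)"
    by (simp only: of_real_eq_iff)
  then show ?thesis by (simp add: powr_def)
qed

section \<open>The heat kernel\<close>

definition heat_term :: "real \<Rightarrow> int \<Rightarrow> nat \<Rightarrow> real" where
  "heat_term t m j = t powi (2 * int j + m) * rGamma (1 + of_nat j) * rGamma (of_int (int j + m + 1))"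

text \<open>
  This is \<open>exp (- 2 t) I\<^sub>m(2 t)\<close> with the modified Bessel function \<open>I\<^sub>m\<close>.
\<close>

definition heat_kernel :: "real \<Rightarrow> int \<Rightarrow> real" where
  "heat_kernel t m = exp (- 2 * t) * (\<Sum>j. heat_term t m j)"

lemma rGamma_fact: "rGamma (1 + real n) = 1 / fact n"
  by (simp add: rGamma_inverse_Gamma Gamma_fact inverse_eq_divide)

text \<open>
  With \<open>i = j + m\<close>, the nonzero terms are \<open>(t\<^sup>j / j!) (t\<^sup>i / i!)\<close>. This symmetric form identifies
  the terms, for all \<open>m\<close> together, with the product of two exponential series, and it shows that the
  kernel is even in \<open>m\<close>.
\<close>

lemma heat_term_eq:
  "heat_term t m j =
    (if int j + m \<ge> 0 then t ^ j / fact j * (t ^ nat (int j + m) / fact (nat (int j + m))) else 0)"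
proof (cases "int j + m \<ge> 0")
  case True
  define i where "i = nat (int j + m)"
  have m: "m = int i - int j" using True by (simp add: i_def)
  have "2 * int j + m = int (j + i)" "of_int (int j + m + 1) = 1 + real i"
    unfolding m by simp_all
  then show ?thesis
    using True unfolding heat_term_def i_def[symmetric]
    by (simp only: power_int_of_nat rGamma_fact power_add) simp
next
  case False
  then have "real_of_int (int j + m + 1) \<in> \<int>\<^sub>\<le>\<^sub>0" by (intro nonpos_Ints_of_int) auto
  then show ?thesis using False
    by (simp only: heat_term_def rGamma_eq_zero_iff[THEN iffD2]) simp
qed

lemma heat_term_nonneg: "t \<ge> 0 \<Longrightarrow> heat_term t m j \<ge> 0"
  by (simp add: heat_term_eq)

lemma has_sum_heat_term:
  assumes "t \<ge> 0"
  shows "((\<lambda>(m, j). heat_term t m j) has_sum exp (2 * t)) UNIV"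
proof -
  have e: "((\<lambda>i. t ^ i / fact i) has_sum exp t) UNIV"
    using assms exp_converges[of t] by (intro sums_nonneg_imp_has_sum) (auto simp: field_simps)
  have 1: "((\<lambda>i. t ^ j / fact j * (t ^ i / fact i)) has_sum (t ^ j / fact j * exp t)) UNIV" for j
    by (rule has_sum_cmult_right[OF e])
  have 2: "((\<lambda>j. t ^ j / fact j * exp t) has_sum (exp t * exp t)) UNIV"
    by (rule has_sum_cmult_left[OF e])
  have "((\<lambda>(j, i). t ^ j / fact j * (t ^ i / fact i)) has_sum (exp t * exp t)) (UNIV \<times> UNIV)"
  proof (rule has_sum_SigmaI)
    show "(\<lambda>(j, i). t ^ j / fact j * (t ^ i / fact i)) summable_on UNIV \<times> UNIV"
      by (rule summable_on_SigmaI[where g = "\<lambda>j. t ^ j / fact j * exp t"])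
         (use 1 2 assms in \<open>auto simp: summable_on_def\<close>)
  qed (use 1 2 in auto)
  also have "?this \<longleftrightarrow> ((\<lambda>(m, j). heat_term t m j) has_sum (exp t * exp t)) {(m, j). int j + m \<ge> 0}"
    by (rule has_sum_reindex_bij_witness[where i = "\<lambda>(m, j). (j, nat (int j + m))"
          and j = "\<lambda>(j, i). (int i - int j, j)"]) (auto simp: heat_term_eq)
  also have "\<dots> \<longleftrightarrow> ((\<lambda>(m, j). heat_term t m j) has_sum (exp t * exp t)) UNIV"
    by (rule has_sum_cong_neutral) (auto simp: heat_term_eq)
  finally show ?thesis by (simp flip: exp_add)
qed

lemma summable_on_heat_term: "t \<ge> 0 \<Longrightarrow> heat_term t m summable_on UNIV"
  using summable_on_SigmaD1[of "heat_term t" UNIV "\<lambda>_. UNIV" m] has_sum_heat_term[of t]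
  by (simp add: has_sum_imp_summable)

lemma heat_kernel_eq_infsum: "t \<ge> 0 \<Longrightarrow> heat_kernel t m = exp (- 2 * t) * infsum (heat_term t m) UNIV"
  unfolding heat_kernel_def
  by (simp only: sums_unique[OF has_sum_imp_sums[OF has_sum_infsum[OF summable_on_heat_term]], symmetric])

lemma heat_kernel_nonneg: "t \<ge> 0 \<Longrightarrow> heat_kernel t m \<ge> 0"
  by (auto simp: heat_kernel_eq_infsum heat_term_nonneg intro!: infsum_nonneg mult_nonneg_nonneg)

lemma has_sum_heat_kernel:
  assumes t: "t \<ge> 0"
  shows "(heat_kernel t has_sum 1) UNIV"
proof -
  have "((\<lambda>m. infsum (heat_term t m) UNIV) has_sum exp (2 * t)) UNIV"
    by (rule has_sum_SigmaD[where f = "\<lambda>(m, j). heat_term t m j" and B = "\<lambda>_. UNIV"])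
       (use has_sum_heat_term[OF t] summable_on_heat_term[OF t] in auto)
  from has_sum_cmult_right[OF this, of "exp (- 2 * t)"]
  have "((\<lambda>m. exp (- 2 * t) * infsum (heat_term t m) UNIV) has_sum 1) UNIV"
    by (simp flip: exp_add)
  moreover have "heat_kernel t = (\<lambda>m. exp (- 2 * t) * infsum (heat_term t m) UNIV)"
    by (rule ext) (rule heat_kernel_eq_infsum[OF t])
  ultimately show ?thesis by simp
qed

lemma heat_kernel_minus:
  assumes t: "t \<ge> 0"
  shows "heat_kernel t (- m) = heat_kernel t m"
proof -
  have "infsum (heat_term t (- m)) UNIV = infsum (heat_term t (- m)) {j. int j - m \<ge> 0}"
    by (rule infsum_cong_neutral) (auto simp: heat_term_eq)
  also have "\<dots> = infsum (heat_term t m) {j. int j + m \<ge> 0}"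
    by (rule infsum_reindex_bij_witness[where i = "\<lambda>j. nat (int j + m)" and j = "\<lambda>j. nat (int j - m)"])
       (auto simp: heat_term_eq mult_ac)
  also have "\<dots> = infsum (heat_term t m) UNIV"
    by (rule infsum_cong_neutral) (auto simp: heat_term_eq)
  finally show ?thesis using t by (simp add: heat_kernel_eq_infsum)
qed

lemma measurable_heat_term [measurable]: "(\<lambda>t. heat_term t m j) \<in> borel_measurable borel"
  unfolding heat_term_eq by measurable

lemma measurable_heat_kernel [measurable]: "(\<lambda>t. heat_kernel t m) \<in> borel_measurable borel"
  unfolding heat_kernel_def by measurable

section \<open>The kernel as an integral of heat kernels\<close>

lemma nn_integral_Gamma_scaled:
  fixes x :: real
  assumes "x > 0"
  shows "(\<integral>\<^sup>+t. ennreal (indicator {0<..} t * (t powr (x - 1) * exp (- 2 * t))) \<partial>lborel) = Gamma x / 2 powr x"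
proof -
  define I where "I = (\<integral>\<^sup>+t. ennreal (indicator {0<..} t * (t powr (x - 1) * exp (- 2 * t))) \<partial>lborel)"
  have "ennreal (Gamma x) = (\<integral>\<^sup>+t. ennreal (indicator {0..} t * t powr (x - 1) / exp t) \<partial>lborel)"
    by (rule Gamma_conv_nn_integral_real[OF assms])
  also have "\<dots> = ennreal \<bar>2\<bar> * (\<integral>\<^sup>+t. ennreal (indicator {0..} (0 + 2 * t) * (0 + 2 * t) powr (x - 1) / exp (0 + 2 * t)) \<partial>lborel)"
    by (rule nn_integral_real_affine) auto
  also have "\<dots> = ennreal 2 * (\<integral>\<^sup>+t. ennreal (2 powr (x - 1)) * ennreal (indicator {0<..} t * (t powr (x - 1) * exp (- 2 * t))) \<partial>lborel)"
    by (simp, intro arg_cong2[where f = "(*)"] refl nn_integral_cong)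
       (auto simp: indicator_def powr_mult exp_minus field_simps simp flip: ennreal_mult')
  also have "\<dots> = ennreal 2 * (ennreal (2 powr (x - 1)) * I)"
    unfolding I_def by (subst nn_integral_cmult) auto
  also have "\<dots> = ennreal (2 powr x) * I"
  proof -
    have "ennreal 2 * ennreal (2 powr (x - 1)) = ennreal (2 * 2 powr (x - 1))"
      by (rule ennreal_mult'[symmetric]) simp
    also have "2 * 2 powr (x - 1) = 2 powr x"
      by (simp add: powr_diff)
    finally show ?thesis by (simp only: mult.assoc[symmetric])
  qed
  finally have "ennreal (Gamma x) = ennreal (2 powr x) * I" .
  then have "ennreal (1 / 2 powr x) * ennreal (Gamma x) = (ennreal (1 / 2 powr x) * ennreal (2 powr x)) * I"
    by (simp only: mult.assoc)
  also have "ennreal (1 / 2 powr x) * ennreal (2 powr x) = ennreal (1 / 2 powr x * 2 powr x)"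
    by (rule ennreal_mult'[symmetric]) simp
  also have "1 / 2 powr x * 2 powr x = (1 :: real)" by simp
  also have "ennreal (1 / 2 powr x) * ennreal (Gamma x) = ennreal (1 / 2 powr x * Gamma x)"
    by (rule ennreal_mult'[symmetric]) simp
  finally show ?thesis unfolding I_def by simp
qed

text \<open>
  Legendre's duplication formula splits \<open>\<Gamma>(2 j + k - r)\<close> into \<open>\<Gamma>(a + j) \<Gamma>(b + j)\<close> with
  \<open>a = (k - r)/2\<close> and \<open>b = a + 1/2\<close>, and the powers of \<open>2\<close> cancel up to a constant. This leaves a
  hypergeometric series with \<open>c = k + 1\<close>. Two further duplications, for \<open>\<Gamma>(a) \<Gamma>(b)\<close> and for
  \<open>\<Gamma>(c - a) \<Gamma>(c - b)\<close>, bring Gauss's value into the form of the kernel.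
\<close>

lemma heat_series_sums:
  fixes r :: real and k :: nat
  assumes r: "0 < r" "r < 1" and k: "k \<ge> 1"
  shows "(\<lambda>j. Gamma (2 * real j + k - r) / 2 powr (2 * real j + k - r) / (fact j * fact (j + k))) sums
         (Gamma (- r) * laplace_kernel r (int k))"
proof -
  define a b c where "a = (k - r) / 2" and "b = (k - r + 1) / 2" and "c = real k + 1"
  have k': "real k \<ge> 1" using k by simp
  have pos: "a > 0" "b > 0" "c > a + b" using r k' by (auto simp: a_def b_def c_def field_simps)
  have t: "Gamma (2 * real j + k - r) / 2 powr (2 * real j + k - r) / (fact j * fact (j + k)) =
     1 / (2 * sqrt pi) * (Gamma (a + real j) * Gamma (b + real j) / (fact j * Gamma (c + real j)))" for j
  proof -
    have "Gamma (a + j) * Gamma (a + j + 1/2) = 2 powr (1 - 2 * (a + j)) * sqrt pi * Gamma (2 * (a + j))"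
      using pos by (intro Gamma_legendre_duplication_real) auto
    also have "2 * (a + j) = 2 * real j + k - r" by (simp add: a_def)
    also have "a + j + 1/2 = b + j" by (simp add: a_def b_def)
    finally have "Gamma (a + j) * Gamma (b + j) =
        2 * sqrt pi * (Gamma (2 * real j + k - r) / 2 powr (2 * real j + k - r))"
      by (simp add: powr_diff mult_ac)
    moreover have "Gamma (c + real j) = fact (j + k)"
      using Gamma_fact[of "j + k", where 'a = real] by (simp add: c_def add_ac)
    ultimately show ?thesis by simp
  qed
  have "Gamma a * Gamma b = 2 powr (1 - (k - r)) * sqrt pi * Gamma (k - r)"
  proof -
    have "2 * a = k - r" "a + 1/2 = b" by (simp_all add: a_def b_def)
    then show ?thesis using Gamma_legendre_duplication_real[OF pos(1)] by simp
  qed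
  moreover have "Gamma (c - a) * Gamma (c - b) = 2 powr (- (k + r)) * sqrt pi * Gamma (k + 1 + r)"
  proof -
    have e: "2 * (c - b) = k + 1 + r" "c - b + 1/2 = c - a" "c - b > 0" "1 - (k + 1 + r) = - (k + r)"
      using pos by (simp_all add: a_def b_def c_def field_simps)
    show ?thesis
      using Gamma_legendre_duplication_real[OF e(3)] unfolding e(1,2,4) by (simp only: mult.commute)
  qed
  moreover have "c - a - b = 1/2 + r"
    by (simp add: a_def b_def c_def field_simps)
  ultimately have "1 / (2 * sqrt pi) * (Gamma a * Gamma b * Gamma (c - a - b) / (Gamma (c - a) * Gamma (c - b))) =
      1 / (2 * sqrt pi) * (2 powr (1 - (k - r)) * sqrt pi * Gamma (k - r) * Gamma (1/2 + r) /
         (2 powr (- (k + r)) * sqrt pi * Gamma (k + 1 + r)))"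
    by simp
  also have "\<dots> = (2 powr (1 - (k - r)) / 2 / 2 powr (- (k + r))) * Gamma (1/2 + r) * Gamma (k - r) /
         (sqrt pi * Gamma (k + 1 + r))"
    by (simp add: mult_ac)
  also have "2 powr (1 - (k - r)) / 2 / 2 powr (- (k + r)) = (4 powr r :: real)"
  proof -
    have "(4::real) powr r = (2 powr 2) powr r" by simp
    also have "\<dots> = 2 powr (2 * r)" by (simp only: powr_powr)
    also have "\<dots> = 2 powr (1 - (k - r)) / 2 powr 1 / 2 powr (- (k + r))"
      by (simp only: powr_diff[symmetric]) (simp add: algebra_simps)
    finally show ?thesis by simp
  qed
  also have "4 powr r * Gamma (1/2 + r) * Gamma (k - r) / (sqrt pi * Gamma (k + 1 + r)) =
      - (Gamma (- r) * frac_kernel r (int k))"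
  proof -
    have "- r \<notin> \<int>\<^sub>\<le>\<^sub>0" using r by (auto elim!: nonpos_Ints_cases')
    then have "Gamma (- r) \<noteq> 0" by (simp add: Gamma_eq_zero_iff)
    then show ?thesis using k by (simp add: frac_kernel_def add_ac mult_ac)
  qed
  also have "\<dots> = Gamma (- r) * laplace_kernel r (int k)"
  proof -
    have "r \<notin> \<nat>" using r by (auto simp: Nats_def)
    then show ?thesis using frac_kernel_eq_laplace_kernel[of r "int k"] r k by simp
  qed
  finally show ?thesis
    unfolding t using sums_mult[OF Gauss_hypergeometric_sums[OF pos], of "1 / (2 * sqrt pi)"] by simp
qed

lemma heat_kernel_of_nat:
  "heat_kernel t (int k) = exp (- 2 * t) * (\<Sum>j. t ^ (2 * j + k) / (fact j * fact (j + k)))"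
proof -
  have "nat (int j + int k) = j + k" for j by simp
  then show ?thesis
    unfolding heat_kernel_def heat_term_eq by (simp add: power_add power_mult power2_eq_square power_mult_distrib mult_ac)
qed

text \<open>
  The subordination formula: integrating the heat kernel against \<open>t\<^sup>-\<^sup>r\<^sup>-\<^sup>1\<close> term by term gives a Gamma
  integral for each term of its power series. For \<open>m = 0\<close> the integral diverges at \<open>t = 0\<close>.
\<close>

lemma nn_integral_heat_kernel:
  assumes r: "0 < r" "r < 1" and m: "m \<noteq> 0"
  shows "(\<integral>\<^sup>+t. ennreal (indicator {0<..} t * (t powr (- r - 1) * heat_kernel t m)) \<partial>lborel)
    = ennreal (Gamma (- r) * laplace_kernel r m)"
    and "Gamma (- r) * laplace_kernel r m \<ge> 0"
proof -
  define k where "k = nat \<bar>m\<bar>"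
  have k: "k \<ge> 1" using m by (simp add: k_def)
  have hk: "heat_kernel t m = heat_kernel t (int k)" if "t > 0" for t
    using heat_kernel_minus[of t m] that by (cases "m \<ge> 0") (auto simp: k_def)
  have lk: "laplace_kernel r m = laplace_kernel r (int k)"
    by (simp add: laplace_kernel_def k_def)
  define x where "x = (\<lambda>j. 2 * real j + k - r)"
  have x: "x j > 0" for j using r k by (simp add: x_def)
  define C where "C = (\<lambda>j. 1 / (fact j * fact (j + k)) :: real)"
  have C: "C j \<ge> 0" for j by (simp add: C_def)
  have "(\<lambda>j. Gamma (x j) / 2 powr x j * C j) sums (Gamma (- r) * laplace_kernel r (int k))"
    using heat_series_sums[OF r k] by (simp add: x_def C_def)
  note sums = this
  show "Gamma (- r) * laplace_kernel r m \<ge> 0"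
    unfolding lk using sums_le[OF _ sums_zero sums] x C by (simp add: less_imp_le)
  have "(\<integral>\<^sup>+t. ennreal (indicator {0<..} t * (t powr (- r - 1) * heat_kernel t m)) \<partial>lborel) =
    (\<integral>\<^sup>+t. (\<Sum>j. ennreal (indicator {0<..} t * (t powr (x j - 1) * exp (- 2 * t))) * ennreal (C j)) \<partial>lborel)"
  proof (rule nn_integral_cong)
    fix t :: real
    show "ennreal (indicator {0<..} t * (t powr (- r - 1) * heat_kernel t m)) =
       (\<Sum>j. ennreal (indicator {0<..} t * (t powr (x j - 1) * exp (- 2 * t))) * ennreal (C j))"
    proof (cases "t > 0")
      case True
      have "summable (heat_term t (int k))"
        using summable_on_heat_term[of t "int k"] True by (intro summable_on_imp_summable) auto
      then have "summable (\<lambda>j. t ^ (2 * j + k) * C j)"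
        by (simp add: heat_term_eq[abs_def] C_def nat_int_add power_add power_mult power2_eq_square power_mult_distrib mult_ac)
      then have "(\<lambda>j. t powr (- r - 1) * (exp (- 2 * t) * (t ^ (2 * j + k) * C j))) sums
        (t powr (- r - 1) * (exp (- 2 * t) * (\<Sum>j. t ^ (2 * j + k) * C j)))"
        by (intro sums_mult summable_sums)
      also have "(t powr (- r - 1) * (exp (- 2 * t) * (\<Sum>j. t ^ (2 * j + k) * C j))) =
         t powr (- r - 1) * heat_kernel t m"
        unfolding hk[OF True] heat_kernel_of_nat by (simp add: C_def)
      also have "(\<lambda>j. t powr (- r - 1) * (exp (- 2 * t) * (t ^ (2 * j + k) * C j))) =
         (\<lambda>j. t powr (x j - 1) * exp (- 2 * t) * C j)"
      proof
        fix j
        have "t powr (x j - 1) = t powr (- r - 1 + real (2 * j + k))" by (simp add: x_def algebra_simps)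
        also have "\<dots> = t powr (- r - 1) * t ^ (2 * j + k)"
          using True by (simp only: powr_add powr_realpow)
        finally show "t powr (- r - 1) * (exp (- 2 * t) * (t ^ (2 * j + k) * C j)) =
          t powr (x j - 1) * exp (- 2 * t) * C j" by simp
      qed
      finally have "(\<Sum>j. ennreal (t powr (x j - 1) * exp (- 2 * t) * C j)) =
         ennreal (t powr (- r - 1) * heat_kernel t m)"
        using C by (intro suminf_ennreal_eq) auto
      then show ?thesis using True C by (simp add: ennreal_mult'')
    qed simp
  qed
  also have "\<dots> = (\<Sum>j. \<integral>\<^sup>+t. ennreal (indicator {0<..} t * (t powr (x j - 1) * exp (- 2 * t))) * ennreal (C j) \<partial>lborel)"
    by (rule nn_integral_suminf) measurable
  also have "\<dots> = (\<Sum>j. ennreal (Gamma (x j) / 2 powr x j) * ennreal (C j))"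
  proof (intro arg_cong[where f = suminf] ext)
    fix j
    have "(\<integral>\<^sup>+t. ennreal (indicator {0<..} t * (t powr (x j - 1) * exp (- 2 * t))) * ennreal (C j) \<partial>lborel) =
       (\<integral>\<^sup>+t. ennreal (indicator {0<..} t * (t powr (x j - 1) * exp (- 2 * t))) \<partial>lborel) * ennreal (C j)"
      by (rule nn_integral_multc) measurable
    then show "(\<integral>\<^sup>+t. ennreal (indicator {0<..} t * (t powr (x j - 1) * exp (- 2 * t))) * ennreal (C j) \<partial>lborel) =
       ennreal (Gamma (x j) / 2 powr x j) * ennreal (C j)"
      by (simp only: nn_integral_Gamma_scaled[OF x])
  qed
  also have "\<dots> = (\<Sum>j. ennreal (Gamma (x j) / 2 powr x j * C j))"
    using C by (simp only: ennreal_mult'')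
  also have "\<dots> = ennreal (Gamma (- r) * laplace_kernel r (int k))"
    using x C by (intro suminf_ennreal_eq sums) (simp add: less_imp_le)
  finally show "(\<integral>\<^sup>+t. ennreal (indicator {0<..} t * (t powr (- r - 1) * heat_kernel t m)) \<partial>lborel)
    = ennreal (Gamma (- r) * laplace_kernel r m)"
    unfolding lk .
qed

lemma has_bochner_integral_heat_kernel:
  assumes r: "0 < r" "r < 1" and m: "m \<noteq> 0"
  shows "has_bochner_integral lborel (\<lambda>t. indicator {0<..} t * (t powr (- r - 1) * heat_kernel t m))
           (Gamma (- r) * laplace_kernel r m)"
proof (rule has_bochner_integral_nn_integral)
  show "AE t in lborel. 0 \<le> indicator {0<..} t * (t powr (- r - 1) * heat_kernel t m)"
    by (intro always_eventually allI) (auto simp: indicator_def heat_kernel_nonneg)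
qed (use nn_integral_heat_kernel[OF assms] in \<open>simp_all\<close>)

section \<open>The fractional power as a convolution\<close>

lemma heat_semigroup_eq_convolve: "heat_semigroup t u n = convolve (heat_kernel t) u n"
  by (simp add: heat_semigroup_def convolve_def heat_kernel_def heat_term_def add_diff_eq)

text \<open>
  Because the heat kernel has mass \<open>1\<close>, the subtraction of \<open>u n\<close> can be moved inside the sum. This
  removes the term \<open>k = n\<close>, the only one that is not integrable against \<open>t\<^sup>-\<^sup>r\<^sup>-\<^sup>1\<close> near \<open>0\<close>.
\<close>

lemma heat_semigroup_diff:
  assumes t: "t \<ge> 0" and u: "bounded (range u)"
  shows "(\<lambda>k. heat_kernel t (n - k) * (u k - u n)) summable_on UNIV"
    and "heat_semigroup t u n - u n = (\<Sum>\<^sub>\<infinity>k. heat_kernel t (n - k) * (u k - u n))"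
proof -
  have h: "(heat_kernel t has_sum 1) UNIV" by (rule has_sum_heat_kernel[OF t])
  have h': "((\<lambda>k. heat_kernel t (n - k)) has_sum 1) UNIV"
    using h by (subst has_sum_reindex_bij_betw[OF bij_int_reflect])
  have "((\<lambda>k. heat_kernel t (n - k) * u k) has_sum convolve (heat_kernel t) u n) UNIV"
    unfolding convolve_def
    by (intro has_sum_infsum summable_on_convolve u has_sum_imp_summable[OF h])
  from has_sum_diff[OF this has_sum_cmult_left[OF h', of "u n"]]
  have "((\<lambda>k. heat_kernel t (n - k) * (u k - u n)) has_sum (heat_semigroup t u n - u n)) UNIV"
    by (simp add: heat_semigroup_eq_convolve right_diff_distrib)
  then show "(\<lambda>k. heat_kernel t (n - k) * (u k - u n)) summable_on UNIV"
    "heat_semigroup t u n - u n = (\<Sum>\<^sub>\<infinity>k. heat_kernel t (n - k) * (u k - u n))"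
    by (auto simp: has_sum_iff)
qed

text \<open>
  The integral of the absolute value of the \<open>k\<close>-th term is
  \<open>\<Gamma>(-r) laplace_kernel r (n - k) \<bar>u k - u n\<bar>\<close>, because the heat kernel is nonnegative. This is
  summable in \<open>k\<close>, so sum and integral may be exchanged.
\<close>

lemma integral_heat_semigroup_diff:
  assumes r: "0 < r" "r < 1" and u: "bounded (range u)"
  shows "(LBINT t:{0<..}. t powr (- r - 1) * (heat_semigroup t u n - u n)) =
         Gamma (- r) * convolve (laplace_kernel r) u n"
proof -
  define h where "h = (\<lambda>k t. indicator {0<..} t * (t powr (- r - 1) * heat_kernel t (n - k)) * (u k - u n))"
  define f where "f = (\<lambda>i. h (int_decode i))"
  define c where "c = (\<lambda>k. Gamma (- r) * laplace_kernel r (n - k))"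
  have hb: "has_bochner_integral lborel (h k) (c k * (u k - u n))" for k
  proof (cases "k = n")
    case True
    then show ?thesis by (simp add: h_def has_bochner_integral_zero)
  next
    case False
    then show ?thesis
      unfolding h_def c_def using r by (intro has_bochner_integral_mult_left has_bochner_integral_heat_kernel) auto
  qed
  have hn: "has_bochner_integral lborel (\<lambda>t. norm (h k t)) \<bar>c k * (u k - u n)\<bar>" for k
  proof (cases "k = n")
    case True
    then show ?thesis by (simp add: h_def has_bochner_integral_zero)
  next
    case False
    have "norm (h k t) = indicator {0<..} t * (t powr (- r - 1) * heat_kernel t (n - k)) * \<bar>u k - u n\<bar>" for t
      by (auto simp: h_def abs_mult indicator_def heat_kernel_nonneg)
    moreover have "\<bar>c k * (u k - u n)\<bar> = c k * \<bar>u k - u n\<bar>"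
    proof -
      have "c k \<ge> 0" using nn_integral_heat_kernel(2)[OF r, of "n - k"] False by (simp add: c_def)
      then show ?thesis by (simp add: abs_mult)
    qed
    moreover have "has_bochner_integral lborel
        (\<lambda>t. indicator {0<..} t * (t powr (- r - 1) * heat_kernel t (n - k)) * \<bar>u k - u n\<bar>) (c k * \<bar>u k - u n\<bar>)"
      unfolding c_def using r False by (intro has_bochner_integral_mult_left has_bochner_integral_heat_kernel) auto
    ultimately show ?thesis by simp
  qed
  have bd: "bounded (range (\<lambda>k. u k - u n))"
  proof -
    obtain B where B: "\<And>k. \<bar>u k\<bar> \<le> B" using u by (auto simp: bounded_iff)
    have "\<bar>u k - u n\<bar> \<le> B + B" for k
      using abs_triangle_ineq4[of "u k" "u n"] B[of k] B[of n] by linarith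
    then show ?thesis by (auto simp: bounded_iff)
  qed
  have sc: "(\<lambda>k. c k * (u k - u n)) summable_on UNIV"
    unfolding c_def mult.assoc
    by (intro summable_on_cmult_right summable_on_convolve summable_on_laplace_kernel less_imp_le r bd)
  have weighted_summable: "(\<lambda>k. t powr (- r - 1) * (heat_kernel t (n - k) * (u k - u n))) summable_on UNIV"
    if "t > 0" for t
    using heat_semigroup_diff(1)[OF _ u, of t n] that by (intro summable_on_cmult_right) auto
  have "(LBINT t:{0<..}. t powr (- r - 1) * (heat_semigroup t u n - u n)) = (\<integral>t. (\<Sum>i. f i t) \<partial>lborel)"
    unfolding set_lebesgue_integral_def
  proof (intro Bochner_Integration.integral_cong refl)
    fix t :: real
    show "indicator {0<..} t *\<^sub>R (t powr (- r - 1) * (heat_semigroup t u n - u n)) = (\<Sum>i. f i t)"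
    proof (cases "t > 0")
      case True
      have "t powr (- r - 1) * (heat_semigroup t u n - u n) =
          (\<Sum>\<^sub>\<infinity>k. t powr (- r - 1) * (heat_kernel t (n - k) * (u k - u n)))"
        using True heat_semigroup_diff[OF _ u, of t n] by (simp add: infsum_cmult_right)
      also have "\<dots> = (\<Sum>i. f i t)"
        unfolding f_def h_def using True
        by (subst infsum_int_eq_suminf(1)[OF weighted_summable[OF True]]) (simp add: mult_ac)
      finally show ?thesis using True by simp
    qed (simp add: f_def h_def)
  qed
  also have "\<dots> = (\<Sum>i. \<integral>t. f i t \<partial>lborel)"
  proof (rule integral_suminf)
    show "integrable lborel (f i)" for i
      unfolding f_def using hb by (simp add: has_bochner_integral_iff)
    show "AE t in lborel. summable (\<lambda>i. norm (f i t))"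
    proof (intro always_eventually allI)
      fix t
      show "summable (\<lambda>i. norm (f i t))"
      proof (cases "t > 0")
        case True
        from infsum_int_eq_suminf(2)[OF weighted_summable[OF True]] show ?thesis
          using True by (simp add: f_def h_def mult_ac)
      qed (simp add: f_def h_def)
    qed
    show "summable (\<lambda>i. \<integral>t. norm (f i t) \<partial>lborel)"
      unfolding f_def has_bochner_integral_integral_eq[OF hn] by (rule infsum_int_eq_suminf(2)[OF sc])
  qed
  also have "\<dots> = (\<Sum>\<^sub>\<infinity>k. c k * (u k - u n))"
    unfolding f_def has_bochner_integral_integral_eq[OF hb] by (rule infsum_int_eq_suminf(1)[OF sc, symmetric])
  also have "\<dots> = Gamma (- r) * (\<Sum>\<^sub>\<infinity>k. laplace_kernel r (n - k) * (u k - u n))"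
    unfolding c_def mult.assoc
    by (intro infsum_cmult_right summable_on_convolve summable_on_laplace_kernel less_imp_le r bd)
  also have "\<dots> = Gamma (- r) * convolve (laplace_kernel r) u n"
    using convolve_laplace_kernel_differences[OF r(1) u] by simp
  finally show ?thesis .
qed

text \<open>
  For non-integer \<open>s = r + m\<close> with \<open>0 < r < 1\<close>, the heat semigroup represents the fractional part \<open>r\<close>,
  and the integer part \<open>m\<close> is absorbed by shifting the parameter of the kernel.
\<close>

lemma frac_laplace_eq_convolve:
  assumes s: "s > 0" and u: "bounded (range u)"
  shows "frac_laplace s u n = convolve (laplace_kernel s) u n"
proof (cases "s \<in> \<nat>")
  case True
  then obtain m where "s = real m" by (auto elim: Nats_cases)
  then show ?thesis
    using convolve_laplace_kernel_of_nat[OF u, of m n] True by (simp add: frac_laplace_def)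
next
  case False
  define m where "m = nat \<lfloor>s\<rfloor>"
  define r where "r = s - of_int \<lfloor>s\<rfloor>"
  have fl: "of_int \<lfloor>s\<rfloor> = real m" using s by (simp add: m_def)
  have sm: "s = r + real m" by (simp add: r_def flip: fl)
  have "r \<noteq> 0" using False sm by auto
  then have r: "0 < r" "r < 1" unfolding r_def by linarith+
  have "- r \<notin> \<int>\<^sub>\<le>\<^sub>0" using r by (auto elim!: nonpos_Ints_cases')
  then have G: "Gamma (- r) \<noteq> 0" by (simp add: Gamma_eq_zero_iff)
  have "frac_laplace s u n = 1 / Gamma (- r) *
      (LBINT t:{0<..}. t powr (- r - 1) * (heat_semigroup t (neg_laplace_pow m u) n - neg_laplace_pow m u n))"
    using False by (simp add: frac_laplace_def m_def r_def)
  also have "\<dots> = convolve (laplace_kernel r) (neg_laplace_pow m u) n"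
    using G by (simp add: integral_heat_semigroup_diff r bounded_neg_laplace_pow u)
  also have "\<dots> = convolve (laplace_kernel s) u n"
    unfolding sm using r by (intro convolve_laplace_kernel_add_nat[symmetric] u) auto
  finally show ?thesis .
qed

theorem theorem6p4:
  fixes s :: real and u :: "int \<Rightarrow> real" and n :: int
  assumes "s > 0" and "u \<in> ell2"
  shows "((\<lambda>z. \<Sum>\<^sub>\<infinity>k\<in>UNIV. frac_kernel z (n - k) * (u n - u k)) \<longlongrightarrow> frac_laplace s u n)
           (at s within ({0<..} - \<nat>))"
proof -
  have u: "bounded (range u)" by (rule ell2_imp_bounded[OF assms(2)])
  have "((\<lambda>z. convolve (laplace_kernel z) u n) \<longlongrightarrow> convolve (laplace_kernel s) u n)
          (at s within ({0<..} - \<nat>))"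
    using tendsto_convolve_laplace_kernel[OF assms(1) u] by (rule tendsto_mono[rotated]) (simp add: at_within_def)
  then have "((\<lambda>z. convolve (laplace_kernel z) u n) \<longlongrightarrow> frac_laplace s u n) (at s within ({0<..} - \<nat>))"
    by (simp add: frac_laplace_eq_convolve assms(1) u)
  then show ?thesis
  proof (rule Lim_transform_eventually)
    have "\<forall>\<^sub>F z in at s within ({0<..} - \<nat>). z \<in> {0<..} - \<nat>"
      by (simp add: eventually_at_filter)
    then show "\<forall>\<^sub>F z in at s within ({0<..} - \<nat>). convolve (laplace_kernel z) u n =
        (\<Sum>\<^sub>\<infinity>k\<in>UNIV. frac_kernel z (n - k) * (u n - u k))"
      by eventually_elim (simp add: infsum_frac_kernel_eq_convolve u)
  qed
qed

end
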